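(* Let $p\geq5$ be a prime. Then $$W(\Gamma_{\mathrm{id}})=0,\quad W(\Gamma_\chi)=\frac12-\frac{1}{2(p+\chi(-1))},\quad W(H_\pm)=\frac{p^2-p-1}{2(p^2-1)},\quad W(\Delta)=1-\frac{p^3-p-1}{(p^2-1)^2}.$$
   Context: Let $G=\mathrm{GL}_2(\mathbb{F}_p)$ and let $\chi$ be the quadratic character (Legendre symbol) of $\mathbb{F}_p^\times$. Subgroups of $G\times G$: $\Gamma_{\mathrm{id}}=\{(g,g):g\in G\}$; $\Gamma_\chi=\{(g,\chi(\det g)g):g\in G\}$; $H_\pm=\{(g,\pm g):g\in G\}$ (both signs allowed); $\Delta=\{(g,h)\in G\times G:\det g=\det h\}$. For a subgroup $H\subseteq G\times G$, the witness ratio is $W(H)=\#\{(g_1,g_2)\in H:\mathrm{tr}(g_1)\neq\mathrm{tr}(g_2)\}/|H|$. In the formula for $W(\Gamma_\chi)$, $\chi(-1)\in\{\pm1\}$ is regarded as an integer. *)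

theory Defs
  imports
    "HOL-Analysis.Analysis"
    "HOL-Number_Theory.Number_Theory"
    "Berlekamp_Zassenhaus.Finite_Field"
begin

text \<open>
  The field with \<open>p\<close> elements is \<open>'p mod_ring\<close>, where \<open>p = CARD('p)\<close>; the sort \<open>prime_card\<close>
  says exactly that \<open>CARD('p)\<close> is prime.
\<close>

type_synonym 'p mat2 = "(('p mod_ring)^2)^2"

definition GL2 :: "'p::prime_card mat2 set" where
  "GL2 = {g. invertible g}"

text \<open>
  Integer-valued, so that its values can be used both as integers and, via \<open>of_int\<close>, as
  scalars of the field; it is extended by \<open>0\<close> to the zero element.
\<close>

definition quad_char :: "'p::prime_card mod_ring \<Rightarrow> int" where
  "quad_char x = Legendre (to_int_mod_ring x) (int CARD('p))"

definition smult_mat2 :: "'p::prime_card mod_ring \<Rightarrow> 'p mat2 \<Rightarrow> 'p mat2" where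
  "smult_mat2 c g = map_matrix (\<lambda>x. c * x) g"

definition Gamma_id :: "('p::prime_card mat2 \<times> 'p mat2) set" where
  "Gamma_id = {(g, g) | g. g \<in> GL2}"

definition Gamma_chi :: "('p::prime_card mat2 \<times> 'p mat2) set" where
  "Gamma_chi = {(g, smult_mat2 (of_int (quad_char (det g))) g) | g. g \<in> GL2}"

text \<open>A single subgroup, containing the pairs for both signs.\<close>

definition H_pm :: "('p::prime_card mat2 \<times> 'p mat2) set" where
  "H_pm = {(g, h) | g h. g \<in> GL2 \<and> (h = g \<or> h = - g)}"

definition Delta :: "('p::prime_card mat2 \<times> 'p mat2) set" where
  "Delta = {(g, h) | g h. g \<in> GL2 \<and> h \<in> GL2 \<and> det g = det h}"

definition witness_ratio :: "('p::prime_card mat2 \<times> 'p mat2) set \<Rightarrow> real" where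
  "witness_ratio H = real (card {(g1, g2) \<in> H. trace g1 \<noteq> trace g2}) / real (card H)"

end

(*
  A matrix with trace t, determinant d and upper left entry a is a solution (b, c) of
  b c = a (t - a) - d, so the number of matrices with given (t, d) is q (q - 1) + q r, where r
  is the number of roots of x^2 - t x + d. No value of r at given (t, d) is ever computed: summing
  r f(t, d) over all t and d amounts to summing f(a + c, a c) over all pairs (a, c) of roots. With
  f an indicator this gives the first moments of r; with f = r it gives the second moment, because
  r = |{a, c}| at (a + c, a c).
*)

theory Submission
  imports Defs
begin

text \<open>The roots of x^2 - t x + d, written so that membership says that a and t - a have sum t
  and product d. Being a set, it counts a double root once.\<close>

definition char_roots :: "'a::field \<Rightarrow> 'a \<Rightarrow> 'a set" where
  "char_roots t d = {a. a * (t - a) = d}"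

definition trace_det_fibre :: "'a::field \<Rightarrow> 'a \<Rightarrow> (('a^2)^2) set" where
  "trace_det_fibre t d = {g. trace g = t \<and> det g = d}"

section \<open>Counting by fibres, and the matrices with given trace and determinant\<close>

lemma card_eq_sum_fibres:
  assumes "finite A" "finite D" "f ` A \<subseteq> D"
  shows "card A = (\<Sum>d\<in>D. card {x\<in>A. f x = d})"
  using sum.group[OF assms, of "\<lambda>_. 1::nat"] by simp

lemma real_card_Diff:
  assumes "finite A" "B \<subseteq> A"
  shows "real (card (A - B)) = real (card A) - real (card B)"
  using assms by (simp add: card_Diff_subset card_mono finite_subset of_nat_diff)

lemma card_nonzero: "card (- {0 :: 'a::{finite,zero}}) = CARD('a) - 1"
  by (simp add: Compl_eq_Diff_UNIV card_Diff_singleton)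

text \<open>For nonzero m, any nonzero b determines c. For m = 0 the curve degenerates into the two
  axes, with q more points; this surplus is what each root of the characteristic polynomial adds to
  a fibre of (trace, det).\<close>

lemma card_hyperbola:
  fixes m :: "'a::{finite,field}"
  shows "card {(b, c). b * c = m} = (CARD('a) - 1) + (if m = 0 then CARD('a) else 0)"
proof (cases "m = 0")
  case True
  have eq: "{(b, c). b * c = m} = {0} \<times> UNIV \<union> (- {0}) \<times> {0}"
    using True by auto
  have "card ({0} \<times> UNIV \<union> (- {0}) \<times> {0} :: ('a \<times> 'a) set) = CARD('a) + (CARD('a) - 1)"
    by (subst card_Un_disjoint) (auto simp: card_cartesian_product card_nonzero)
  then show ?thesis
    using True eq by simp
next
  case False
  have "{(b, c). b * c = m} = (\<lambda>b. (b, m / b)) ` (- {0})"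
    using False by (auto simp: image_iff field_simps)
  moreover have "inj_on (\<lambda>b. (b, m / b)) (- {0})"
    by (auto simp: inj_on_def)
  ultimately show ?thesis
    using False by (simp add: card_image card_nonzero)
qed

lemma card_trace_det_fibre:
  fixes t d :: "'a::{finite,field}"
  shows "card (trace_det_fibre t d) = CARD('a) * (CARD('a) - 1) + CARD('a) * card (char_roots t d)"
proof -
  let ?S = "SIGMA a:UNIV. {(b, c). b * c = a * (t - a) - d}"
  let ?f = "\<lambda>(a, b, c). vector [vector [a, b], vector [c, t - a]] :: ('a^2)^2"
  have "bij_betw ?f ?S (trace_det_fibre t d)"
    by (rule bij_betw_byWitness[where f' = "\<lambda>g. (g$1$1, g$1$2, g$2$1)"])
       (auto simp: trace_det_fibre_def trace_def det_2 sum_2 vec_eq_iff forall_2 algebra_simps)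
  then have "card (trace_det_fibre t d) = card ?S"
    by (simp add: bij_betw_same_card)
  also have "\<dots> = (\<Sum>a\<in>UNIV. (CARD('a) - 1) + (if a * (t - a) - d = 0 then CARD('a) else 0))"
    by (subst card_SigmaI) (simp_all add: card_hyperbola)
  also have "\<dots> = (\<Sum>a\<in>(UNIV::'a set). CARD('a) - 1)
      + (\<Sum>a\<in>UNIV. if a * (t - a) - d = 0 then CARD('a) else 0)"
    by (rule sum.distrib)
  also have "\<dots> = CARD('a) * (CARD('a) - 1) + CARD('a) * card (char_roots t d)"
    by (simp add: char_roots_def flip: sum.inter_filter)
  finally show ?thesis .
qed

section \<open>Moments of the number of roots\<close>

lemma char_roots_add_mult: "char_roots (a + c) (a * c) = {a, c}"
proof -
  have "b * (a + c - b) = a * c \<longleftrightarrow> (b - a) * (b - c) = 0" for b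
    by (auto simp: algebra_simps)
  then show ?thesis
    by (auto simp: char_roots_def)
qed

text \<open>Both sides sum over triples (t, d, a) with a a root for (t, d). Such a triple is
  determined by a and the other root c = t - a, because then t = a + c and d = a c; conversely every
  pair (a, c) arises.\<close>

lemma sum_card_char_roots:
  fixes f :: "'a::{finite,field} \<Rightarrow> 'a \<Rightarrow> 'b::comm_semiring_1"
  shows "(\<Sum>(t, d)\<in>UNIV. of_nat (card (char_roots t d)) * f t d)
    = (\<Sum>(a, c)\<in>UNIV. f (a + c) (a * c))"
proof -
  have "(\<Sum>(t, d)\<in>UNIV. of_nat (card (char_roots t d)) * f t d)
      = (\<Sum>p\<in>UNIV. \<Sum>a\<in>char_roots (fst p) (snd p). f (fst p) (snd p))"
    by (simp add: case_prod_beta)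
  also have "\<dots> = (\<Sum>(p, a)\<in>(SIGMA p:UNIV. char_roots (fst p) (snd p)). f (fst p) (snd p))"
    by (subst sum.Sigma) auto
  also have "\<dots> = (\<Sum>(a, c)\<in>UNIV. f (a + c) (a * c))"
    by (rule sum.reindex_bij_witness[where i = "\<lambda>(a, c). ((a + c, a * c), a)"
          and j = "\<lambda>(p, a). (a, fst p - a)"]) (auto simp: char_roots_def)
  finally show ?thesis .
qed

text \<open>Moves the restriction on t and d into a 0/1 weight, which is the form that
  \<open>sum_card_char_roots\<close> accepts.\<close>

lemma sum_pairs_det:
  fixes f :: "'a::finite \<Rightarrow> 'a \<Rightarrow> 'b::comm_semiring_1"
  shows "(\<Sum>d\<in>D. \<Sum>t\<in>T. f t d) = (\<Sum>(t, d)\<in>UNIV. of_bool (t \<in> T \<and> d \<in> D) * f t d)"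
proof -
  have "(\<Sum>d\<in>D. \<Sum>t\<in>T. f t d) = (\<Sum>t\<in>T. \<Sum>d\<in>D. f t d)"
    by (rule sum.swap)
  also have "\<dots> = (\<Sum>(t, d)\<in>T \<times> D. f t d)"
    by (simp add: sum.cartesian_product)
  also have "\<dots> = (\<Sum>(t, d)\<in>UNIV. of_bool (t \<in> T \<and> d \<in> D) * f t d)"
    by (rule sum.mono_neutral_cong_left) (auto simp: of_bool_def split: if_splits)
  finally show ?thesis .
qed

lemma sum_card_char_roots_on:
  fixes T D :: "'a::{finite,field} set"
  shows "(\<Sum>d\<in>D. \<Sum>t\<in>T. card (char_roots t d)) = card {(a, c). a + c \<in> T \<and> a * c \<in> D}"
proof -
  have "(\<Sum>d\<in>D. \<Sum>t\<in>T. card (char_roots t d))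
      = (\<Sum>(t, d)\<in>UNIV. of_nat (card (char_roots t d)) * of_bool (t \<in> T \<and> d \<in> D))"
    by (simp add: sum_pairs_det mult.commute)
  also have "\<dots> = (\<Sum>(a, c)\<in>UNIV. of_bool (a + c \<in> T \<and> a * c \<in> D))"
    by (rule sum_card_char_roots)
  also have "\<dots> = card {(a, c). a + c \<in> T \<and> a * c \<in> D}"
    by (simp add: case_prod_unfold sum_of_bool_eq)
  finally show ?thesis .
qed

text \<open>A nonzero product means that both roots are nonzero, so the sum runs over (q - 1)^2
  pairs (a, c). Each contributes 2, except the q - 1 diagonal pairs, which contribute 1. The missing
  q - 1 is added on the left to avoid subtraction of naturals.\<close>

lemma sum_card_char_roots_sq:
  "(\<Sum>d\<in>-{0}. \<Sum>t\<in>UNIV. card (char_roots t (d::'a::{finite,field})) ^ 2) + (CARD('a) - 1)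
    = 2 * (CARD('a) - 1) ^ 2"
proof -
  let ?N = "- {0} :: 'a set"
  have "(\<Sum>d\<in>?N. \<Sum>t\<in>UNIV. card (char_roots t d) ^ 2)
      = (\<Sum>(t, d)\<in>(UNIV :: ('a \<times> 'a) set). of_nat (card (char_roots t d)) * (of_bool (d \<noteq> 0) * card (char_roots t d)))"
    by (simp add: sum_pairs_det power2_eq_square mult.left_commute)
  also have "\<dots> = (\<Sum>(a, c)\<in>UNIV. of_bool (a * c \<noteq> (0::'a)) * card (char_roots (a + c) (a * c)))"
    by (rule sum_card_char_roots)
  also have "\<dots> = (\<Sum>(a, c)\<in>?N \<times> ?N. card {a, c})"
    by (rule sum.mono_neutral_cong_right) (auto simp: char_roots_add_mult of_bool_def split: if_splits)
  finally have 1: "(\<Sum>d\<in>?N. \<Sum>t\<in>UNIV. card (char_roots t d) ^ 2) = (\<Sum>a\<in>?N. \<Sum>c\<in>?N. card {a, c})"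
    by (simp add: sum.cartesian_product)
  have 2: "(\<Sum>c\<in>?N. card {a, c}) + 1 = 2 * card ?N" if "a \<in> ?N" for a
  proof -
    \<comment> \<open>The extra 1 is assigned to the single term c = a, where \<open>{a, c}\<close>
      is a singleton; then all terms equal 2.\<close>
    have "(\<Sum>c\<in>?N. card {a, c}) + 1 = (\<Sum>c\<in>?N. card {a, c} + (if c = a then 1 else 0))"
      using that by (simp add: sum.distrib sum.delta')
    also have "\<dots> = (\<Sum>c\<in>?N. 2)"
      by (rule sum.cong) auto
    finally show ?thesis by simp
  qed
  have "(\<Sum>a\<in>?N. \<Sum>c\<in>?N. card {a, c}) + card ?N = (\<Sum>a\<in>?N. (\<Sum>c\<in>?N. card {a, c}) + 1)"
    by (simp only: sum.distrib) simp
  also have "\<dots> = (\<Sum>a\<in>?N. 2 * card ?N)"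
    by (rule sum.cong[OF refl 2])
  also have "\<dots> = 2 * card ?N ^ 2"
    by (simp add: power2_eq_square)
  finally show ?thesis
    using 1 by (simp add: card_nonzero)
qed

section \<open>Matrices with trace and determinant in prescribed sets\<close>

lemma card_trace_det_sets:
  fixes T D :: "'a::{finite,field} set"
  shows "card {g::('a^2)^2. trace g \<in> T \<and> det g \<in> D} = (\<Sum>d\<in>D. \<Sum>t\<in>T. card (trace_det_fibre t d))"
proof -
  let ?A = "{g::('a^2)^2. trace g \<in> T \<and> det g \<in> D}"
  have fibre: "{g\<in>?A. (trace g, det g) = y} = trace_det_fibre (fst y) (snd y)" if "y \<in> T \<times> D" for y
    using that by (auto simp: trace_det_fibre_def)
  have "card ?A = (\<Sum>y\<in>T \<times> D. card {g\<in>?A. (trace g, det g) = y})"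
    by (rule card_eq_sum_fibres) auto
  also have "\<dots> = (\<Sum>y\<in>T \<times> D. card (trace_det_fibre (fst y) (snd y)))"
    by (intro sum.cong refl arg_cong[where f = card] fibre)
  also have "\<dots> = (\<Sum>t\<in>T. \<Sum>d\<in>D. card (trace_det_fibre t d))"
    by (simp add: sum.cartesian_product case_prod_unfold)
  also have "\<dots> = (\<Sum>d\<in>D. \<Sum>t\<in>T. card (trace_det_fibre t d))"
    by (rule sum.swap)
  finally show ?thesis .
qed

lemma card_trace_det_sets_eq:
  fixes T D :: "'a::{finite,field} set"
  shows "card {g::('a^2)^2. trace g \<in> T \<and> det g \<in> D}
    = card D * card T * (CARD('a) * (CARD('a) - 1))
      + CARD('a) * card {(a, c). a + c \<in> T \<and> a * c \<in> D}"
  unfolding card_trace_det_sets card_trace_det_fibre sum_card_char_roots_on[symmetric]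
  by (simp only: sum.distrib sum_distrib_left sum_constant) simp

text \<open>With the trace free, the root pairs are the q - 1 points of a c = d, so the count is q *
  q (q - 1) + q (q - 1).\<close>

lemma card_det_eq:
  fixes d :: "'a::{finite,field}"
  assumes "d \<noteq> 0"
  shows "card {g::('a^2)^2. det g = d} = CARD('a) * (CARD('a)\<^sup>2 - 1)"
proof -
  \<comment> \<open>Substituting \<open>Suc n\<close> removes the truncated subtractions, leaving a
    polynomial identity in n.\<close>
  obtain n where n: "CARD('a) = Suc n"
    using not0_implies_Suc by fastforce
  show ?thesis
    using card_trace_det_sets_eq[of UNIV "{d}"] assms
    by (simp add: card_hyperbola n power2_eq_square algebra_simps)
qed

lemma card_det_in:
  fixes D :: "'a::{finite,field} set"
  assumes "0 \<notin> D"
  shows "card {g::('a^2)^2. det g \<in> D} = card D * (CARD('a) * (CARD('a)\<^sup>2 - 1))"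
proof -
  have "card {g::('a^2)^2. det g \<in> D} = (\<Sum>d\<in>D. card {g\<in>{g::('a^2)^2. det g \<in> D}. det g = d})"
    by (rule card_eq_sum_fibres) auto
  also have "\<dots> = (\<Sum>d\<in>D. card {g::('a^2)^2. det g = d})"
    by (rule sum.cong) (auto intro!: arg_cong[where f = card])
  also have "\<dots> = (\<Sum>d\<in>D. CARD('a) * (CARD('a)\<^sup>2 - 1))"
    using assms by (intro sum.cong refl card_det_eq) auto
  finally show ?thesis
    by simp
qed

text \<open>Trace 0 makes the roots a and - a, with product - a^2. For D the nonsquares, the last
  term thus depends on whether - 1 is a square.\<close>

lemma card_traceless_det_in:
  fixes D :: "'a::{finite,field} set"
  shows "card {g::('a^2)^2. trace g = 0 \<and> det g \<in> D}
    = card D * (CARD('a) * (CARD('a) - 1)) + CARD('a) * card {a. - (a\<^sup>2) \<in> D}"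
proof -
  have eq: "{(a, c). a + c = 0 \<and> a * c \<in> D} = (\<lambda>a. (a, - a)) ` {a. - (a\<^sup>2) \<in> D}"
    by (auto simp: image_iff power2_eq_square add_eq_0_iff)
  have "card {(a, c). a + c = 0 \<and> a * c \<in> D} = card {a. - (a\<^sup>2) \<in> D}"
    unfolding eq by (rule card_image) (auto simp: inj_on_def)
  then show ?thesis
    using card_trace_det_sets_eq[of "{0}" D] by simp
qed

section \<open>Pairs of matrices with equal determinant\<close>

lemma card_equal_det:
  "card {(g, h). det (g::('a::{finite,field}^2)^2) \<noteq> 0 \<and> det g = det (h::('a^2)^2)}
    = (CARD('a) - 1) * (CARD('a) * (CARD('a)\<^sup>2 - 1))\<^sup>2"
proof -
  have eq: "{(g, h). det (g::('a^2)^2) \<noteq> 0 \<and> det g = det (h::('a^2)^2)}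
      = (SIGMA g:{g. det g \<in> - {0}}. {h. det h = det g})"
    by auto
  have "card {(g, h). det (g::('a^2)^2) \<noteq> 0 \<and> det g = det (h::('a^2)^2)}
      = (\<Sum>g\<in>{g::('a^2)^2. det g \<in> - {0}}. card {h::('a^2)^2. det h = det g})"
    unfolding eq by (rule card_SigmaI) auto
  also have "\<dots> = (\<Sum>g\<in>{g::('a^2)^2. det g \<in> - {0}}. CARD('a) * (CARD('a)\<^sup>2 - 1))"
    by (rule sum.cong) (auto simp: card_det_eq)
  also have "\<dots> = card {g::('a^2)^2. det g \<in> - {0}} * (CARD('a) * (CARD('a)\<^sup>2 - 1))"
    by simp
  finally show ?thesis
    by (subst (asm) card_det_in) (auto simp: card_nonzero power2_eq_square)
qed

text \<open>The pairs are counted by the squares of the fibre sizes q (q - 1) + q r. Expanding the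
  square leaves the sums of r and of r^2 over all t and all nonzero d, which are (q - 1)^2 and 2 (q
  - 1)^2 - (q - 1).\<close>

lemma card_equal_trace_det:
  "real (card {(g::('a::{finite,field}^2)^2, h). det g \<noteq> 0 \<and> det g = det (h::('a^2)^2) \<and> trace g = trace h})
    = real CARD('a) ^ 2 * (real CARD('a) - 1) * (real CARD('a) ^ 3 - real CARD('a) - 1)"
proof -
  let ?N = "- {0} :: 'a set" and ?q = "real CARD('a)"
  let ?A = "{(g, h). det (g::('a^2)^2) \<noteq> 0 \<and> det g = det (h::('a^2)^2) \<and> trace g = trace h}"
  have q: "CARD('a) \<ge> 1"
    by (simp add: Suc_leI)
  have fibre: "{x\<in>?A. (trace (fst x), det (fst x)) = y}
      = trace_det_fibre (fst y) (snd y) \<times> trace_det_fibre (fst y) (snd y)"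
    if "y \<in> UNIV \<times> ?N" for y
    using that by (auto simp: trace_det_fibre_def)
  have "card ?A = (\<Sum>y\<in>UNIV \<times> ?N. card {x\<in>?A. (trace (fst x), det (fst x)) = y})"
    by (rule card_eq_sum_fibres) auto
  also have "\<dots> = (\<Sum>y\<in>UNIV \<times> ?N. card (trace_det_fibre (fst y) (snd y) \<times> trace_det_fibre (fst y) (snd y)))"
    by (intro sum.cong refl arg_cong[where f = card] fibre)
  also have "\<dots> = (\<Sum>t\<in>UNIV. \<Sum>d\<in>?N. card (trace_det_fibre t d) ^ 2)"
    by (simp add: sum.cartesian_product case_prod_unfold card_cartesian_product power2_eq_square)
  also have "\<dots> = (\<Sum>d\<in>?N. \<Sum>t\<in>UNIV. card (trace_det_fibre t d) ^ 2)"
    by (rule sum.swap)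
  finally have "real (card ?A)
      = (\<Sum>d\<in>?N. \<Sum>t\<in>UNIV. (?q * (?q - 1) + ?q * real (card (char_roots t d))) ^ 2)"
    using q by (simp add: card_trace_det_fibre of_nat_diff)
  also have "\<dots> = (\<Sum>d\<in>?N. \<Sum>t\<in>UNIV. (?q * (?q - 1)) ^ 2
      + 2 * ?q ^ 2 * (?q - 1) * real (card (char_roots t d)) + ?q ^ 2 * real (card (char_roots t d) ^ 2))"
    by (intro sum.cong refl) (simp add: power2_eq_square algebra_simps)
  also have "\<dots> = (?q - 1) * ?q * (?q * (?q - 1)) ^ 2
      + 2 * ?q ^ 2 * (?q - 1) * real (\<Sum>d\<in>?N. \<Sum>t\<in>UNIV. card (char_roots t d))
      + ?q ^ 2 * real (\<Sum>d\<in>?N. \<Sum>t\<in>UNIV. card (char_roots t d) ^ 2)"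
    using q by (simp add: sum.distrib card_nonzero of_nat_diff sum_distrib_left)
  also have "real (\<Sum>d\<in>?N. \<Sum>t\<in>UNIV. card (char_roots t d)) = (?q - 1) ^ 2"
  proof -
    have "{(a, c). a + c \<in> UNIV \<and> a * c \<in> ?N} = ?N \<times> ?N"
      by auto
    then show ?thesis
      by (simp only: sum_card_char_roots_on)
         (use q in \<open>simp add: card_cartesian_product card_nonzero power2_eq_square of_nat_diff\<close>)
  qed
  also have "real (\<Sum>d\<in>?N. \<Sum>t\<in>UNIV. card (char_roots t d) ^ 2) = 2 * (?q - 1) ^ 2 - (?q - 1)"
    using arg_cong[OF sum_card_char_roots_sq[where 'a = 'a], of real] q
    by (simp add: of_nat_diff)
  finally show ?thesis
    using q by (simp add: of_nat_diff power2_eq_square power3_eq_cube algebra_simps)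
qed

section \<open>Squares in a finite field of odd characteristic\<close>

lemma eq_uminus_iff:
  fixes x :: "'a::field"
  assumes "(2::'a) \<noteq> 0"
  shows "x = - x \<longleftrightarrow> x = 0"
  using assms by (metis add_eq_0_iff mult_2 mult_eq_0_iff neg_equal_0_iff_equal)

text \<open>Squaring is two-to-one on the nonzero elements, since z and - z differ. Hence half of
  these are squares and the other half are not; 0 is a square and so is absent from the
  count.\<close>

lemma card_nonsquares:
  assumes "(2::'a::{finite,field}) \<noteq> 0"
  shows "2 * card {x::'a. \<nexists>y. y\<^sup>2 = x} = CARD('a) - 1"
proof -
  let ?S = "{x::'a. x \<noteq> 0 \<and> (\<exists>y. y\<^sup>2 = x)}" and ?N = "{x::'a. \<nexists>y. y\<^sup>2 = x}"
  have "card {y\<in>- {0}. y\<^sup>2 = x} = 2" if x: "x \<in> ?S" for x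
  proof -
    obtain z where z: "z \<noteq> 0" "x = z\<^sup>2"
      using x by auto
    have "z \<noteq> - z"
      using z(1) by (simp only: eq_uminus_iff[OF assms] not_False_eq_True)
    moreover have "{y\<in>- {0}. y\<^sup>2 = x} = {z, - z}"
      using z by (auto simp: power2_eq_iff)
    ultimately show ?thesis
      by simp
  qed
  moreover have "card (- {0::'a}) = (\<Sum>x\<in>?S. card {y\<in>- {0}. y\<^sup>2 = x})"
    by (rule card_eq_sum_fibres) auto
  ultimately have S: "CARD('a) - 1 = 2 * card ?S"
    by (simp add: card_nonzero)
  have "- {0} = ?S \<union> ?N" "?S \<inter> ?N = {}"
    by auto
  then have "card (- {0::'a}) = card ?S + card ?N"
    by (simp only: card_Un_disjoint finite)
  then show ?thesis
    using S by (simp add: card_nonzero)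
qed

text \<open>For nonzero a, dividing or multiplying by a shows that - a^2 is a square exactly when -
  1 is. So either every a is excluded, or only a = 0 is.\<close>

lemma card_neg_square_nonsquare:
  "card {a::'a::{finite,field}. \<nexists>y. y\<^sup>2 = - (a\<^sup>2)} = (if \<exists>i::'a. i\<^sup>2 = - 1 then 0 else CARD('a) - 1)"
proof -
  have "(\<exists>y. y\<^sup>2 = - (a\<^sup>2)) \<longleftrightarrow> a = 0 \<or> (\<exists>i::'a. i\<^sup>2 = - 1)" for a :: 'a
  proof (cases "a = 0")
    case False
    have "(y / a)\<^sup>2 = - 1" if "y\<^sup>2 = - (a\<^sup>2)" for y
      using that False by (simp add: power_divide)
    moreover have "(i * a)\<^sup>2 = - (a\<^sup>2)" if "i\<^sup>2 = - 1" for i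
      using that by (simp add: power_mult_distrib)
    ultimately show ?thesis
      using False by blast
  qed auto
  then have "{a::'a. \<nexists>y. y\<^sup>2 = - (a\<^sup>2)} = (if \<exists>i::'a. i\<^sup>2 = - 1 then {} else - {0})"
    by auto
  then show ?thesis
    by (simp add: card_nonzero)
qed

section \<open>The Legendre symbol in terms of squares of the field\<close>

lemma of_int_mod_ring_eq_iff:
  "(of_int a :: 'p::prime_card mod_ring) = of_int b \<longleftrightarrow> [a = b] (mod int CARD('p))"
  unfolding of_int_of_int_mod_ring cong_def by transfer simp

text \<open>\<open>QuadRes\<close> asks for an integer root modulo p. Every field element is the
  image of an integer, so this is the same as a root in the field.\<close>

lemma quad_char_eq:
  fixes x :: "'p::prime_card mod_ring"
  shows "quad_char x = (if x = 0 then 0 else if \<exists>y. y\<^sup>2 = x then 1 else - 1)"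
proof -
  have x: "of_int (to_int_mod_ring x) = x"
    by (simp add: of_int_of_int_mod_ring)
  have "[to_int_mod_ring x = 0] (mod int CARD('p)) \<longleftrightarrow> x = 0"
    using of_int_mod_ring_eq_iff[of "to_int_mod_ring x" 0, where 'p = 'p] x by simp
  moreover have "QuadRes (int CARD('p)) (to_int_mod_ring x) \<longleftrightarrow> (\<exists>y. y\<^sup>2 = x)"
  proof -
    have "QuadRes (int CARD('p)) (to_int_mod_ring x) \<longleftrightarrow> (\<exists>k. (of_int k)\<^sup>2 = x)"
      unfolding QuadRes_def using x by (simp flip: of_int_mod_ring_eq_iff)
    also have "\<dots> \<longleftrightarrow> (\<exists>y. y\<^sup>2 = x)"
      by (metis of_int_mod_ring_to_int_mod_ring of_int_of_int_mod_ring)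
    finally show ?thesis .
  qed
  ultimately show ?thesis
    by (simp add: quad_char_def Legendre_def)
qed

section \<open>The four witness ratios\<close>

lemma GL2_eq: "GL2 = {g. det g \<in> - {0}}"
  by (auto simp: GL2_def invertible_det_nz)

lemma real_card_GL2:
  "real (card (GL2 :: 'p::prime_card mat2 set))
    = (real CARD('p) - 1) * (real CARD('p) * (real CARD('p) ^ 2 - 1))"
  unfolding GL2_eq by (subst card_det_in) (simp_all add: card_nonzero of_nat_diff)

lemma trace_smult_mat2: "trace (smult_mat2 c g) = c * trace g"
  by (simp add: smult_mat2_def map_matrix_def trace_def sum_2 algebra_simps)

lemma trace_uminus: "trace (- g) = - trace (g :: ('a::comm_ring_1^2)^2)"
  by (simp add: trace_def sum_2)

lemma witness_ratio_Gamma_id: "witness_ratio (Gamma_id :: ('p::prime_card mat2 \<times> 'p mat2) set) = 0"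
proof -
  have "{(g1, g2 :: 'p mat2) \<in> Gamma_id. trace g1 \<noteq> trace g2} = {}"
    by (auto simp: Gamma_id_def)
  then show ?thesis
    by (simp only: witness_ratio_def card.empty of_nat_0 div_0)
qed

text \<open>The twist changes the trace exactly when the determinant is a nonsquare and the trace is
  nonzero. Half of \<open>GL2\<close> has nonsquare determinant; from this half the traceless
  matrices are removed, and their number brings in the value of the character at - 1.\<close>

lemma witness_ratio_Gamma_chi:
  assumes "(2::'p::prime_card mod_ring) \<noteq> 0"
  shows "witness_ratio (Gamma_chi :: ('p mat2 \<times> 'p mat2) set)
    = 1 / 2 - 1 / (2 * (real CARD('p) + real_of_int (quad_char (- 1 :: 'p mod_ring))))"
proof -
  let ?q = "real CARD('p)" and ?\<epsilon> = "real_of_int (quad_char (- 1 :: 'p mod_ring))"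
  let ?N = "{x::'p mod_ring. \<nexists>y. y\<^sup>2 = x}"
  let ?f = "\<lambda>g::'p mat2. (g, smult_mat2 (of_int (quad_char (det g))) g)"
  let ?T = "{g::'p mat2. trace g = 0 \<and> det g \<in> ?N}"
  have q: "?q > 1"
    using prime_card[where 'a = 'p] prime_gt_1_nat by simp
  have inj: "inj_on ?f A" for A
    by (auto simp: inj_on_def)
  have N: "real (card ?N) = (?q - 1) / 2"
    using arg_cong[OF card_nonsquares[OF assms], of real] q by (simp add: of_nat_diff)
  have Gamma: "Gamma_chi = ?f ` GL2"
    by (auto simp: Gamma_chi_def)
  have neq: "trace g \<noteq> trace (smult_mat2 (of_int (quad_char (det g))) g)
      \<longleftrightarrow> det g \<in> ?N \<and> trace g \<noteq> 0" if "g \<in> GL2" for g :: "'p mat2"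
  proof -
    have "trace g = - trace g \<longleftrightarrow> trace g = 0"
      by (rule eq_uminus_iff[OF assms])
    then show ?thesis
      using that by (auto simp: trace_smult_mat2 quad_char_eq GL2_eq)
  qed
  have "{(g1, g2 :: 'p mat2) \<in> Gamma_chi. trace g1 \<noteq> trace g2} = ?f ` {g. det g \<in> ?N \<and> trace g \<noteq> 0}"
  proof -
    have "g \<in> GL2" if "det g \<in> ?N" for g :: "'p mat2"
      using that zero_power2 by (auto simp: GL2_eq)
    then show ?thesis
      unfolding Gamma using neq by blast
  qed
  moreover have "{g::'p mat2. det g \<in> ?N \<and> trace g \<noteq> 0} = {g. det g \<in> ?N} - ?T"
    by auto
  ultimately have "card {(g1, g2 :: 'p mat2) \<in> Gamma_chi. trace g1 \<noteq> trace g2}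
      = card ({g::'p mat2. det g \<in> ?N} - ?T)"
    by (simp only: card_image[OF inj])
  also have "real \<dots> = real (card {g::'p mat2. det g \<in> ?N}) - real (card ?T)"
    by (rule real_card_Diff) (auto simp: GL2_eq)
  \<comment> \<open>The witness 0 shows that 0 is a square, so \<open>?N\<close> avoids 0 as
    \<open>card_det_in\<close> requires.\<close>
  also have "real (card {g::'p mat2. det g \<in> ?N}) = (?q - 1) / 2 * (?q * (?q ^ 2 - 1))"
    unfolding N[symmetric] by (subst card_det_in) (auto intro: exI[of _ 0])
  \<comment> \<open>If - 1 is a square, no - a^2 is a nonsquare and the last factor is q - 1.
    Otherwise the q - 1 nonzero a raise it by 2, to q + 1. Both cases read q -
    \<open>?\<epsilon>\<close>.\<close>
  also have "real (card ?T) = (?q - 1) / 2 * (?q * (?q - ?\<epsilon>))"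
  proof -
    have "real (card ?T) = (?q - 1) / 2 * (?q * (?q - 1))
        + ?q * (if \<exists>i::'p mod_ring. i\<^sup>2 = - 1 then 0 else ?q - 1)"
      unfolding N[symmetric] card_traceless_det_in unfolding mem_Collect_eq card_neg_square_nonsquare
      using q by (simp add: of_nat_diff)
    also have "\<dots> = (?q - 1) / 2 * (?q * (?q - ?\<epsilon>))"
      by (cases "\<exists>i::'p mod_ring. i\<^sup>2 = - 1") (simp_all add: quad_char_eq field_simps)
    finally show ?thesis .
  qed
  finally have "witness_ratio (Gamma_chi :: ('p mat2 \<times> 'p mat2) set)
      = ((?q - 1) / 2 * (?q * (?q ^ 2 - 1)) - (?q - 1) / 2 * (?q * (?q - ?\<epsilon>)))
        / ((?q - 1) * (?q * (?q ^ 2 - 1)))"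
    by (simp add: witness_ratio_def Gamma card_image[OF inj] real_card_GL2)
  also have "\<dots> = 1 / 2 - (?q - ?\<epsilon>) / (2 * (?q ^ 2 - 1))"
  proof -
    have "?q ^ 2 - 1 \<noteq> 0"
      using q by (simp add: power2_eq_1_iff)
    moreover have "(a / 2 * (q * c) - a / 2 * (q * d)) / (a * (q * c)) = 1 / 2 - d / (2 * c)"
      if "a \<noteq> 0" "q \<noteq> 0" "c \<noteq> 0" for a q c d :: real
      using that by (simp add: field_simps)
    ultimately show ?thesis
      using q by simp
  qed
  \<comment> \<open>Since \<open>?\<epsilon>\<close> is 1 or - 1, its square is 1; the factor q -
    \<open>?\<epsilon>\<close> then cancels.\<close>
  also have "?q ^ 2 - 1 = (?q - ?\<epsilon>) * (?q + ?\<epsilon>)"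
    by (simp add: quad_char_eq power2_eq_square algebra_simps)
  also have "(?q - ?\<epsilon>) / (2 * \<dots>) = 1 / (2 * (?q + ?\<epsilon>))"
    using q by (simp add: quad_char_eq)
  finally show ?thesis .
qed

text \<open>The group consists of two disjoint copies of \<open>GL2\<close>, one for each sign. Only
  pairs (g, - g) can be witnesses, and they fail to be exactly when g has trace 0, which happens for
  q^2 (q - 1) elements of \<open>GL2\<close>.\<close>

lemma witness_ratio_H_pm:
  assumes "(2::'p::prime_card mod_ring) \<noteq> 0"
  shows "witness_ratio (H_pm :: ('p mat2 \<times> 'p mat2) set)
    = (real CARD('p) ^ 2 - real CARD('p) - 1) / (2 * (real CARD('p) ^ 2 - 1))"
proof -
  let ?q = "real CARD('p)"
  let ?T = "{g::'p mat2. trace g = 0 \<and> det g \<in> - {0}}"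
  let ?f = "\<lambda>g::'p mat2. (g, - g)" and ?e = "\<lambda>g::'p mat2. (g, g)"
  have q: "?q > 1"
    using prime_card[where 'a = 'p] prime_gt_1_nat by simp
  \<comment> \<open>The two copies are disjoint because 2 is nonzero: g = - g would make every entry
    vanish.\<close>
  have "g \<noteq> - g" if "g \<in> GL2" for g :: "'p mat2"
  proof
    assume "g = - g"
    then have "g $ i $ j = 0" for i j
      using eq_uminus_iff[OF assms] by (metis vector_uminus_component)
    then show False
      using that by (simp add: GL2_eq det_2)
  qed
  then have disj: "?e ` GL2 \<inter> ?f ` GL2 = {}"
    by auto
  have H: "H_pm = ?e ` GL2 \<union> ?f ` GL2"
    by (auto simp: H_pm_def)
  have "card (H_pm :: ('p mat2 \<times> 'p mat2) set) = 2 * card (GL2 :: 'p mat2 set)"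
    unfolding H using disj by (simp add: card_Un_disjoint card_image inj_on_def)
  moreover have "real (card {(g1, g2) \<in> H_pm. trace g1 \<noteq> trace (g2 :: 'p mat2)})
      = real (card (GL2 :: 'p mat2 set)) - real (card ?T)"
  proof -
    have "trace g = trace (- g) \<longleftrightarrow> trace g = 0" for g :: "'p mat2"
      by (simp only: trace_uminus eq_uminus_iff[OF assms])
    then have "{(g1, g2) \<in> H_pm. trace g1 \<noteq> trace g2} = ?f ` (GL2 - ?T)"
      unfolding H GL2_eq by blast
    then have "card {(g1, g2) \<in> H_pm. trace g1 \<noteq> trace (g2 :: 'p mat2)} = card (GL2 - ?T)"
      by (simp add: card_image inj_on_def)
    also have "real \<dots> = real (card (GL2 :: 'p mat2 set)) - real (card ?T)"
      by (rule real_card_Diff) (auto simp: GL2_eq)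
    finally show ?thesis .
  qed
  moreover have "real (card ?T) = (?q - 1) * ?q ^ 2"
  proof -
    have "{a::'p mod_ring. - (a\<^sup>2) \<in> - {0}} = - {0}"
      by auto
    then have "real (card ?T) = (?q - 1) * (?q * (?q - 1)) + ?q * (?q - 1)"
      unfolding card_traceless_det_in using q by (simp add: card_nonzero of_nat_diff)
    then show ?thesis
      by (simp add: power2_eq_square algebra_simps)
  qed
  ultimately have "witness_ratio (H_pm :: ('p mat2 \<times> 'p mat2) set)
      = ((?q - 1) * (?q * (?q ^ 2 - 1)) - (?q - 1) * ?q ^ 2) / (2 * ((?q - 1) * (?q * (?q ^ 2 - 1))))"
    by (simp add: witness_ratio_def real_card_GL2)
  moreover have "?q ^ 2 - 1 \<noteq> 0"
    using q by (simp add: power2_eq_1_iff)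
  moreover have "(a * (q * c) - a * q ^ 2) / (2 * (a * (q * c))) = (c - q) / (2 * c)"
    if "a \<noteq> 0" "q \<noteq> 0" "c \<noteq> 0" for a q c :: real
    using that by (simp add: power2_eq_square field_simps)
  ultimately have "witness_ratio (H_pm :: ('p mat2 \<times> 'p mat2) set)
      = (?q ^ 2 - 1 - ?q) / (2 * (?q ^ 2 - 1))"
    using q by simp
  then show ?thesis
    by (simp add: diff_diff_eq add.commute)
qed

text \<open>The complement of the witnesses is the set of pairs agreeing in both trace and
  determinant. The factor q^2 (q - 1) is common to its size and to that of \<open>Delta\<close>, and
  cancels.\<close>

lemma witness_ratio_Delta:
  "witness_ratio (Delta :: ('p::prime_card mat2 \<times> 'p mat2) set)
    = 1 - (real CARD('p) ^ 3 - real CARD('p) - 1) / (real CARD('p) ^ 2 - 1) ^ 2"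
proof -
  let ?q = "real CARD('p)"
  let ?A = "{(g::'p mat2, h::'p mat2). det g \<noteq> 0 \<and> det g = det h \<and> trace g = trace h}"
  have q: "?q > 1"
    using prime_card[where 'a = 'p] prime_gt_1_nat by simp
  have Delta: "Delta = {(g::'p mat2, h::'p mat2). det g \<noteq> 0 \<and> det g = det h}"
    by (auto simp: Delta_def GL2_eq)
  have card_Delta: "real (card (Delta :: ('p mat2 \<times> 'p mat2) set)) = (?q - 1) * (?q * (?q ^ 2 - 1)) ^ 2"
    using q by (simp add: Delta card_equal_det of_nat_diff)
  have "{(g1, g2) \<in> Delta. trace g1 \<noteq> trace g2} = Delta - ?A"
    by (auto simp: Delta)
  then have "real (card {(g1, g2) \<in> Delta. trace g1 \<noteq> trace (g2 :: 'p mat2)})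
      = real (card (Delta :: ('p mat2 \<times> 'p mat2) set)) - real (card ?A)"
    by (simp only:) (rule real_card_Diff, auto simp: Delta)
  also have "real (card ?A) = ?q ^ 2 * (?q - 1) * (?q ^ 3 - ?q - 1)"
    using card_equal_trace_det[where 'a = "'p mod_ring"] by simp
  finally have "witness_ratio (Delta :: ('p mat2 \<times> 'p mat2) set)
      = ((?q - 1) * (?q * (?q ^ 2 - 1)) ^ 2 - ?q ^ 2 * (?q - 1) * (?q ^ 3 - ?q - 1))
        / ((?q - 1) * (?q * (?q ^ 2 - 1)) ^ 2)"
    by (simp add: witness_ratio_def card_Delta)
  moreover have "?q ^ 2 - 1 \<noteq> 0"
    using q by (simp add: power2_eq_1_iff)
  ultimately show ?thesis
    using q by (simp add: diff_divide_distrib power_mult_distrib)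
qed

theorem theorem3p16:
  fixes p :: nat
  assumes "p = CARD('p::prime_card)" and "p \<ge> 5"
  shows "witness_ratio (Gamma_id :: ('p mat2 \<times> 'p mat2) set) = 0
    \<and> witness_ratio (Gamma_chi :: ('p mat2 \<times> 'p mat2) set)
           = 1 / 2 - 1 / (2 * (real p + real_of_int (quad_char (- 1 :: 'p mod_ring))))
    \<and> witness_ratio (H_pm :: ('p mat2 \<times> 'p mat2) set)
           = (real p ^ 2 - real p - 1) / (2 * (real p ^ 2 - 1))
    \<and> witness_ratio (Delta :: ('p mat2 \<times> 'p mat2) set)
           = 1 - (real p ^ 3 - real p - 1) / (real p ^ 2 - 1) ^ 2"
proof -
  \<comment> \<open>The lower bound on \<open>p\<close> enters here: it exceeds 2, so it cannot
    divide 2, and 2 is nonzero in the field.\<close>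
  have "\<not> int CARD('p) dvd 2"
    using assms zdvd_imp_le by fastforce
  then have "(2 :: 'p mod_ring) \<noteq> 0"
    using of_int_mod_ring_eq_iff[of 2 0, where 'p = 'p] by (simp add: cong_0_iff)
  then show ?thesis
    using assms(1) by (simp add: witness_ratio_Gamma_id witness_ratio_Gamma_chi witness_ratio_H_pm
        witness_ratio_Delta)
qed

end
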